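(* Consider the estimation setting described in the context, and let $\{(\alpha^{(t)},\beta^{(t)})\}_{t\ge 0}$ be the iterates generated by either the GD algorithm (with $F_n=L_n$) or the VI algorithm (with $F_n=Q_n$). Assume the following: (i) all iterates lie in a compact set $\Omega\subset\mathcal{A}\times\mathbb{R}^{m\times K}$, and $F_n$ is bounded from below on $\Omega$; (ii) $F_n$ is differentiable and $\nabla F_n$ is $L$-Lipschitz on an open neighborhood of a compact set containing all iterates and all blockwise update segments, i.e. the line segments from $(\alpha^{(t)},\beta^{(t)})$ to $(\alpha^{(t)},\beta^{(t+1)})$ and from $(\alpha^{(t)},\beta^{(t+1)})$ to $(\alpha^{(t+1)},\beta^{(t+1)})$ for all $t$; (iii) the step sizes satisfy $0<\underline\gamma_\beta\le\gamma_{\beta,t}\le\bar\gamma_\beta<2/L$ and $0<\underline\gamma_\alpha\le\gamma_{\alpha,t}\le\bar\gamma_\alpha<1/L$ for all $t$, for some constants $\underline\gamma_\beta,\bar\gamma_\beta,\underline\gamma_\alpha,\bar\gamma_\alpha$. Then: (a) every accumulation point $(\bar\alpha,\bar\beta)$ of the iterates is a first-order stationary point, in the sense that $\nabla_\beta F_n(\bar\alpha,\bar\beta)=0$ and $(I-\bar\alpha_j\bar\alpha_j^\top)\nabla_{\alpha_j}F_n(\bar\alpha,\bar\beta)=0$ for every $j=1,\dots,m$; (b) if moreover the function $\Psi(\alpha,\beta)=F_n(\alpha,\beta)+\iota_{\mathcal{A}}(\alpha)$ satisfies the Kurdyka–Łojasiewicz property, then the (bounded) sequence of iterates converges to a stationary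 point; (c) as $T\to\infty$, \[\min_{0\le t<T}\Bigg(\sum_{j=1}^m\Big\|\big(I-\alpha_j^{(t)}{\alpha_j^{(t)}}^\top\big)\nabla_{\alpha_j}F_n\big(\alpha^{(t)},\beta^{(t)}\big)\Big\|_2+\Big\|\nabla_\beta F_n\big(\alpha^{(t)},\beta^{(t)}\big)\Big\|_F\Bigg)=\mathcal{O}(T^{-1/2}).\]
   Context: Model: a generalized additive index model with known invertible link $g:\mathbb{R}\to\mathbb{R}$, $g(\mathbb{E}[y\mid x])=\sum_{j=1}^m f_j(\alpha_j^\top x)$, $x\in\mathbb{R}^d$. The ridge functions are expanded in given basis functions $\phi_1,\dots,\phi_K:\mathbb{R}\to\mathbb{R}$, giving $f(x;\alpha,\beta)=\sum_{j=1}^m\sum_{k=1}^K\beta_{jk}\phi_k(\alpha_j^\top x)$ with parameters $\alpha=(\alpha_1,\dots,\alpha_m)\in\mathbb{R}^{d\times m}$ (columns $\alpha_j$) and $\beta=(\beta_{jk})\in\mathbb{R}^{m\times K}$. Data $\{(x_i,y_i)\}_{i=1}^n$ are given; $\mu_i=g^{-1}(f(x_i;\alpha,\beta))$. The constraint set is $\mathcal{A}=\{\alpha\in\mathbb{R}^{d\times m}:\|\alpha_j\|_2=1,\ j=1,\dots,m\}$, $\Pi_{\mathcal{A}}$ denotes Euclidean projection onto $\mathcal{A}$ (columnwise normalization), and $\iota_{\mathcal{A}}$ is its indicator function ($0$ on $\mathcal{A}$, $+\infty$ off it). $\nabla_{\alpha_j}$ denotes the gradient with respect to the $j$-th column of $\alpha$.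 GD algorithm: given a loss $\ell(y,\mu)$, let $L_n(\alpha,\beta)=\frac1n\sum_{i=1}^n\ell(y_i,\mu_i)$, and iterate $\beta^{(t+1)}=\beta^{(t)}-\gamma_{\beta,t}\nabla_\beta L_n(\alpha^{(t)},\beta^{(t)})$, $\alpha^{(t+1)}=\Pi_{\mathcal{A}}\big(\alpha^{(t)}-\gamma_{\alpha,t}\nabla_\alpha L_n(\alpha^{(t)},\beta^{(t+1)})\big)$, starting from some $\alpha^{(0)}\in\mathcal{A}$, $\beta^{(0)}$. For GD, $F_n:=L_n$. VI algorithm: let $\Phi(x;\alpha)=(\phi_k(\alpha_j^\top x))_{j,k}\in\mathbb{R}^{m\times K}$, $V_n^\beta(\alpha,\beta)=\frac1n\sum_{i=1}^n(\mu_i-y_i)\Phi(x_i;\alpha)$, $V_n^\alpha(\alpha,\beta)=\frac1n\sum_{i=1}^n(\mu_i-y_i)\nabla_\alpha f(x_i;\alpha,\beta)\in\mathbb{R}^{d\times m}$, and iterate $\beta^{(t+1)}=\beta^{(t)}-\gamma_{\beta,t}V_n^\beta(\alpha^{(t)},\beta^{(t)})$, $\alpha^{(t+1)}=\Pi_{\mathcal{A}}\big(\alpha^{(t)}-\gamma_{\alpha,t}V_n^\alpha(\alpha^{(t)},\beta^{(t+1)})\big)$. For VI, $F_n:=Q_n$ where $Q_n(\alpha,\beta)=\frac1n\sum_{i=1}^n\int_0^{f(x_i;\alpha,\beta)}\big(g^{-1}(s)-y_i\big)\,ds$ (so that $\nabla_\beta Q_n=V_n^\beta$, $\nabla_\alpha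 Q_n=V_n^\alpha$). The Kurdyka–Łojasiewicz property is meant in the standard sense for proper lower semicontinuous functions used in nonconvex proximal alternating minimization analyses. *)

theory Defs
  imports "HOL-Analysis.Analysis" "HOL-Library.Landau_Symbols"
begin

(* Parameters: alpha :: real^'d^'m  (alpha $ j = j-th column alpha_j in R^d),
               beta  :: real^'k^'m  (beta $ j $ k = beta_jk).
   The norm on real^'d^'m / real^'k^'m is the Frobenius norm; on pairs it is the
   joint Euclidean norm. *)

type_synonym ('d,'m,'k) param = "(real^'d^'m) \<times> (real^'k^'m)"

definition constraint_set :: "(real^'d^'m) set" where
  "constraint_set = {\<alpha>. \<forall>j. norm (\<alpha> $ j) = 1}"

definition projA :: "real^'d^'m \<Rightarrow> real^'d^'m" where
  "projA \<alpha> = (\<chi> j. (1 / norm (\<alpha> $ j)) *\<^sub>R (\<alpha> $ j))"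

definition gaim :: "('k::finite \<Rightarrow> real \<Rightarrow> real) \<Rightarrow> real^'d::finite \<Rightarrow> real^'d^'m::finite \<Rightarrow> real^'k^'m \<Rightarrow> real" where
  "gaim \<phi> x \<alpha> \<beta> = (\<Sum>j\<in>UNIV. \<Sum>k\<in>UNIV. \<beta> $ j $ k * \<phi> k (\<alpha> $ j \<bullet> x))"

definition mu :: "(real \<Rightarrow> real) \<Rightarrow> ('k::finite \<Rightarrow> real \<Rightarrow> real) \<Rightarrow> real^'d::finite \<Rightarrow> real^'d^'m::finite \<Rightarrow> real^'k^'m \<Rightarrow> real" where
  "mu ginv \<phi> x \<alpha> \<beta> = ginv (gaim \<phi> x \<alpha> \<beta>)"

definition Ln :: "(real \<Rightarrow> real \<Rightarrow> real) \<Rightarrow> (real \<Rightarrow> real) \<Rightarrow> ('k::finite \<Rightarrow> real \<Rightarrow> real)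
    \<Rightarrow> nat \<Rightarrow> (nat \<Rightarrow> real^'d) \<Rightarrow> (nat \<Rightarrow> real) \<Rightarrow> ('d::finite,'m::finite,'k::finite) param \<Rightarrow> real" where
  "Ln loss ginv \<phi> n x y p =
     (1 / real n) * (\<Sum>i<n. loss (y i) (mu ginv \<phi> (x i) (fst p) (snd p)))"

definition Qn :: "(real \<Rightarrow> real) \<Rightarrow> ('k::finite \<Rightarrow> real \<Rightarrow> real)
    \<Rightarrow> nat \<Rightarrow> (nat \<Rightarrow> real^'d) \<Rightarrow> (nat \<Rightarrow> real) \<Rightarrow> ('d::finite,'m::finite,'k::finite) param \<Rightarrow> real" where
  "Qn ginv \<phi> n x y p =
     (1 / real n) * (\<Sum>i<n. (LBINT s=ereal 0..ereal (gaim \<phi> (x i) (fst p) (snd p)). ginv s - y i))"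

definition Phi :: "('k::finite \<Rightarrow> real \<Rightarrow> real) \<Rightarrow> real^'d::finite \<Rightarrow> real^'d^'m::finite \<Rightarrow> real^'k^'m" where
  "Phi \<phi> x \<alpha> = (\<chi> j k. \<phi> k (\<alpha> $ j \<bullet> x))"

definition grad_alpha_f :: "('k::finite \<Rightarrow> real \<Rightarrow> real) \<Rightarrow> real^'d::finite \<Rightarrow> real^'d^'m::finite \<Rightarrow> real^'k^'m \<Rightarrow> real^'d^'m" where
  "grad_alpha_f \<phi> x \<alpha> \<beta> = (\<chi> j. (\<Sum>k\<in>UNIV. \<beta> $ j $ k * deriv (\<phi> k) (\<alpha> $ j \<bullet> x)) *\<^sub>R x)"

definition Vbeta :: "(real \<Rightarrow> real) \<Rightarrow> ('k::finite \<Rightarrow> real \<Rightarrow> real)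
    \<Rightarrow> nat \<Rightarrow> (nat \<Rightarrow> real^'d) \<Rightarrow> (nat \<Rightarrow> real) \<Rightarrow> real^'d^'m \<Rightarrow> real^'k^'m \<Rightarrow> real^'k^'m" where
  "Vbeta ginv \<phi> n x y \<alpha> \<beta> =
     (1 / real n) *\<^sub>R (\<Sum>i<n. (mu ginv \<phi> (x i) \<alpha> \<beta> - y i) *\<^sub>R Phi \<phi> (x i) \<alpha>)"

definition Valpha :: "(real \<Rightarrow> real) \<Rightarrow> ('k::finite \<Rightarrow> real \<Rightarrow> real)
    \<Rightarrow> nat \<Rightarrow> (nat \<Rightarrow> real^'d) \<Rightarrow> (nat \<Rightarrow> real) \<Rightarrow> real^'d^'m \<Rightarrow> real^'k^'m \<Rightarrow> real^'d^'m" where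
  "Valpha ginv \<phi> n x y \<alpha> \<beta> =
     (1 / real n) *\<^sub>R (\<Sum>i<n. (mu ginv \<phi> (x i) \<alpha> \<beta> - y i) *\<^sub>R grad_alpha_f \<phi> (x i) \<alpha> \<beta>)"

definition grad :: "('a::real_inner \<Rightarrow> real) \<Rightarrow> 'a \<Rightarrow> 'a" where
  "grad F p = (SOME G. GDERIV F p :> G)"

definition grad_alpha :: "(('d::finite,'m::finite,'k::finite) param \<Rightarrow> real) \<Rightarrow> ('d::finite,'m::finite,'k::finite) param \<Rightarrow> real^'d^'m" where
  "grad_alpha F p = fst (grad F p)"

definition grad_beta :: "(('d::finite,'m::finite,'k::finite) param \<Rightarrow> real) \<Rightarrow> ('d::finite,'m::finite,'k::finite) param \<Rightarrow> real^'k^'m" where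
  "grad_beta F p = snd (grad F p)"

definition tangent_proj :: "real^'d \<Rightarrow> real^'d \<Rightarrow> real^'d" where
  "tangent_proj a v = v - (a \<bullet> v) *\<^sub>R a"

definition stationary :: "(('d::finite,'m::finite,'k::finite) param \<Rightarrow> real) \<Rightarrow> ('d::finite,'m::finite,'k::finite) param \<Rightarrow> bool" where
  "stationary F p \<longleftrightarrow> grad_beta F p = 0 \<and>
     (\<forall>j. tangent_proj (fst p $ j) (grad_alpha F p $ j) = 0)"

definition alt_iter ::
  "(real^'d^'m \<Rightarrow> real^'k^'m \<Rightarrow> real^'k^'m) \<Rightarrow> (real^'d^'m \<Rightarrow> real^'k^'m \<Rightarrow> real^'d^'m)
   \<Rightarrow> (nat \<Rightarrow> real) \<Rightarrow> (nat \<Rightarrow> real) \<Rightarrow> (nat \<Rightarrow> real^'d^'m) \<Rightarrow> (nat \<Rightarrow> real^'k^'m) \<Rightarrow> bool" where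
  "alt_iter Ub Ua ga gb a b \<longleftrightarrow> a 0 \<in> constraint_set \<and>
     (\<forall>t. b (Suc t) = b t - gb t *\<^sub>R Ub (a t) (b t) \<and>
          a (Suc t) = projA (a t - ga t *\<^sub>R Ua (a t) (b (Suc t))))"

definition GD_iter where
  "GD_iter F ga gb a b = alt_iter (\<lambda>\<alpha> \<beta>. grad_beta F (\<alpha>, \<beta>)) (\<lambda>\<alpha> \<beta>. grad_alpha F (\<alpha>, \<beta>)) ga gb a b"

definition VI_iter where
  "VI_iter ginv \<phi> n x y ga gb a b =
     alt_iter (Vbeta ginv \<phi> n x y) (Valpha ginv \<phi> n x y) ga gb a b"

definition Psi :: "(('d::finite,'m::finite,'k::finite) param \<Rightarrow> real) \<Rightarrow> ('d::finite,'m::finite,'k::finite) param \<Rightarrow> ereal" where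
  "Psi F p = (if fst p \<in> constraint_set then ereal (F p) else \<infinity>)"

definition frechet_subdiff :: "('a::real_inner \<Rightarrow> ereal) \<Rightarrow> 'a \<Rightarrow> 'a set" where
  "frechet_subdiff \<Psi> z = {v. \<bar>\<Psi> z\<bar> \<noteq> \<infinity> \<and>
     (\<forall>\<epsilon>>0. \<forall>\<^sub>F w in at z. \<Psi> z + ereal (v \<bullet> (w - z) - \<epsilon> * norm (w - z)) \<le> \<Psi> w)}"

definition limiting_subdiff :: "('a::real_inner \<Rightarrow> ereal) \<Rightarrow> 'a \<Rightarrow> 'a set" where
  "limiting_subdiff \<Psi> z = {v. \<exists>zs vs. zs \<longlonglongrightarrow> z \<and> (\<lambda>k. \<Psi> (zs k)) \<longlonglongrightarrow> \<Psi> z \<and>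
      (\<forall>k. vs k \<in> frechet_subdiff \<Psi> (zs k)) \<and> vs \<longlonglongrightarrow> v}"

(* KL property at zbar (Attouch-Bolte-Redont-Soubeyran); dist(0, dS(z)) >= 1/phi'
   is written out as: for all v in dS(z), phi'(..) * |v| >= 1 (vacuous if empty). *)
definition KL_at :: "('a::real_inner \<Rightarrow> ereal) \<Rightarrow> 'a \<Rightarrow> bool" where
  "KL_at \<Psi> zbar \<longleftrightarrow> (\<exists>\<eta>>0. \<exists>U \<kappa> \<kappa>'. open U \<and> zbar \<in> U \<and>
      concave_on {0..<\<eta>} \<kappa> \<and> continuous_on {0..<\<eta>} \<kappa> \<and> \<kappa> 0 = 0 \<and>
      (\<forall>s\<in>{0<..<\<eta>}. (\<kappa> has_real_derivative \<kappa>' s) (at s) \<and> \<kappa>' s > 0) \<and>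
      continuous_on {0<..<\<eta>} \<kappa>' \<and>
      (\<forall>z\<in>U. \<Psi> zbar < \<Psi> z \<and> \<Psi> z < \<Psi> zbar + ereal \<eta> \<longrightarrow>
          (\<forall>v\<in>limiting_subdiff \<Psi> z. 1 \<le> \<kappa>' (real_of_ereal (\<Psi> z - \<Psi> zbar)) * norm v)))"

definition KL_function :: "('a::real_inner \<Rightarrow> ereal) \<Rightarrow> bool" where
  "KL_function \<Psi> \<longleftrightarrow> (\<forall>z. limiting_subdiff \<Psi> z \<noteq> {} \<longrightarrow> KL_at \<Psi> z)"

end

theory Submission
  imports Defs
begin

text \<open>
  The VI field is the gradient of the potential \<open>Q\<^sub>n\<close>, so both algorithms are alternating gradient
  descent with a projection onto a product of spheres. The descent lemma for the \<open>\<beta>\<close>-step, and the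
  fact that the projected point is no farther from the gradient step than the old iterate for the
  \<open>\<alpha>\<close>-step, give a decrease of \<open>F\<close> by at least \<open>c\<close> times the squared step length. The normalized
  point is parallel to the unprojected one, hence the tangential gradient at the new iterate is at most
  \<open>K\<close> times the step length. Square summability of the steps yields stationarity of accumulation
  points and the rate. The tangential gradient is moreover a subgradient of \<open>\<Psi>\<close>, and the
  Kurdyka-Lojasiewicz inequality at an accumulation point then forces the whole sequence to converge
  to it.
\<close>

section \<open>Gradients\<close>

lemma grad_eqI:
  assumes "GDERIV F p :> G"
  shows "grad F p = G"
proof -
  have "GDERIV F p :> grad F p"
    unfolding grad_def using assms by (rule someI)
  then have "(\<lambda>h. h \<bullet> grad F p) = (\<lambda>h. h \<bullet> G)"
    using assms unfolding gderiv_def by (rule has_derivative_unique)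
  then show ?thesis
    by (metis vector_eq_ldot)
qed

text \<open>The adjoint of the derivative, applied to 1, is its Riesz vector, so differentiability
  makes the choice in \<open>grad\<close> meaningful.\<close>

lemma GDERIV_grad:
  fixes F :: "'a::euclidean_space \<Rightarrow> real"
  assumes "F differentiable (at p)"
  shows "GDERIV F p :> grad F p"
proof -
  obtain F' where F': "(F has_derivative F') (at p)"
    using assms unfolding differentiable_def by blast
  have "F' = (\<lambda>h. h \<bullet> adjoint F' 1)"
    using adjoint_works[OF has_derivative_linear[OF F'], of _ 1] by (auto simp: fun_eq_iff)
  then have "GDERIV F p :> adjoint F' 1"
    using F' unfolding gderiv_def by metis
  then show ?thesis
    using grad_eqI by metis
qed

text \<open>Subtracting the quadratic model from \<open>F\<close> along the segment leaves a
  function with nonpositive derivative, by Cauchy-Schwarz and the Lipschitz bound. The hypotheses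
  are confined to the segment because the neighbourhood on which they will hold may fail to be
  convex.\<close>

lemma descent_lemma:
  fixes F :: "'a::real_inner \<Rightarrow> real"
  assumes deriv: "\<And>u. u \<in> closed_segment p q \<Longrightarrow> GDERIV F u :> G u"
    and lip: "\<And>u. u \<in> closed_segment p q \<Longrightarrow> norm (G u - G p) \<le> L * dist u p"
  shows "F q \<le> F p + G p \<bullet> (q - p) + L / 2 * (norm (q - p))\<^sup>2"
proof -
  define h where
    "h s = F (p + s *\<^sub>R (q - p)) - s * (G p \<bullet> (q - p)) - L / 2 * s\<^sup>2 * (norm (q - p))\<^sup>2" for s
  have "h 1 \<le> h 0"
  proof (rule DERIV_nonpos_imp_nonincreasing[where f = h])
    fix s :: real
    assume s: "0 \<le> s" "s \<le> 1"
    define u where "u = p + s *\<^sub>R (q - p)"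
    have u: "u \<in> closed_segment p q"
      unfolding u_def closed_segment_def using s by (auto simp: algebra_simps intro!: exI[of _ s])
    have "((\<lambda>s. F (p + s *\<^sub>R (q - p))) has_derivative (\<lambda>r. (r *\<^sub>R (q - p)) \<bullet> G u)) (at s)"
      using deriv[OF u] unfolding gderiv_def u_def
      by (intro has_derivative_compose[of "\<lambda>s. p + s *\<^sub>R (q - p)" "\<lambda>r. r *\<^sub>R (q - p)" s UNIV F])
        (auto intro!: derivative_eq_intros)
    then have 1: "((\<lambda>s. F (p + s *\<^sub>R (q - p))) has_real_derivative G u \<bullet> (q - p)) (at s)"
      unfolding has_field_derivative_def
      by (rule back_subst[of "\<lambda>d. (_ has_derivative d) _"]) (auto simp: inner_commute)
    have "(h has_real_derivative
        (G u \<bullet> (q - p) - G p \<bullet> (q - p) - L * s * (norm (q - p))\<^sup>2)) (at s)"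
      unfolding h_def by (rule derivative_eq_intros 1 refl | simp)+
    moreover have "(G u - G p) \<bullet> (q - p) \<le> L * s * (norm (q - p))\<^sup>2"
    proof -
      have "(G u - G p) \<bullet> (q - p) \<le> norm (G u - G p) * norm (q - p)"
        by (rule norm_cauchy_schwarz)
      also have "\<dots> \<le> (L * dist u p) * norm (q - p)"
        using lip[OF u] by (intro mult_right_mono) auto
      also have "\<dots> = L * s * (norm (q - p))\<^sup>2"
        using s by (simp add: u_def dist_norm power2_eq_square)
      finally show ?thesis .
    qed
    ultimately show "\<exists>d. (h has_real_derivative d) (at s) \<and> d \<le> 0"
      by (metis (no_types) diff_le_0_iff_le inner_diff_left)
  qed simp
  then show ?thesis
    by (simp add: h_def)
qed

section \<open>Convergence of descent sequences\<close>

text \<open>This is the tangent bound for the convex function \<open>- \<kappa>\<close>. The tangent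
  point \<open>s\<close> is interior, while \<open>r\<close> may be the endpoint 0, which later
  gives \<open>\<kappa> (e t) \<ge> 0\<close>.\<close>

lemma concave_on_le_tangent:
  fixes \<kappa> :: "real \<Rightarrow> real"
  assumes conc: "concave_on {0..<\<eta>} \<kappa>" and s: "s \<in> {0<..<\<eta>}" and r: "r \<in> {0..<\<eta>}"
    and d: "(\<kappa> has_real_derivative D) (at s)"
  shows "\<kappa> r \<le> \<kappa> s + D * (r - s)"
proof -
  have "s \<in> interior {0..<\<eta>}"
    by (rule interiorI[of "{0<..<\<eta>}"]) (use s in auto)
  then have "(- D) * (r - s) \<le> (- \<kappa> r) - (- \<kappa> s)"
    using conc r d unfolding concave_on_def
    by (intro convex_on_imp_above_tangent[where A = "{0..<\<eta>}" and f = "\<lambda>x. - \<kappa> x"])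
      (auto intro!: derivative_eq_intros intro: has_field_derivative_at_within)
  then show ?thesis
    by simp
qed

text \<open>With \<open>d t\<close> the step lengths and \<open>e t\<close> the optimality gaps, the potential
  \<open>P t = d (t - 1) + (K / c) \<kappa> (e t)\<close> satisfies \<open>d t + P (t + 1) \<le> P t\<close> as long as the iterate is
  close to the accumulation point; hence an iterate that is close enough traps all later ones.\<close>

lemma KL_descent_sequence_converges:
  fixes z w :: "nat \<Rightarrow> 'a::real_inner" and \<Psi> :: "'a \<Rightarrow> ereal" and f :: "nat \<Rightarrow> real"
  assumes \<Psi>_z: "\<And>t. \<Psi> (z t) = ereal (f t)" and \<Psi>_zbar: "\<Psi> zbar = ereal fbar"
    and lim: "f \<longlonglongrightarrow> fbar"
    and c: "c > 0" and descent: "\<And>t. f (Suc t) \<le> f t - c * (dist (z (Suc t)) (z t))\<^sup>2"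
    and w: "\<And>t. w t \<in> limiting_subdiff \<Psi> (z t)"
    and w_le: "\<And>t. norm (w (Suc t)) \<le> K * dist (z (Suc t)) (z t)"
    and K: "K \<ge> 0"
    and r: "strict_mono r" "(z \<circ> r) \<longlonglongrightarrow> zbar"
    and KL: "KL_at \<Psi> zbar"
  shows "z \<longlonglongrightarrow> zbar"
proof -
  define d where "d t = dist (z (Suc t)) (z t)" for t
  have descent': "c * (d t)\<^sup>2 \<le> f t - f (Suc t)" for t
    using descent[of t] by (simp add: d_def)
  have "decseq f"
    using descent' c by (intro decseq_SucI) (meson diff_ge_0_iff_ge less_imp_le mult_nonneg_nonneg
        order_trans zero_le_power2)
  then have f_ge: "fbar \<le> f t" for t
    using lim by (rule decseq_ge)
  show ?thesis
  \<comment> \<open>The KL inequality is silent at the level \<open>fbar\<close> itself. If that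
    level is reached, monotonicity freezes \<open>f\<close> and the decrease forces all later steps
    to be zero.\<close>
  proof (cases "\<exists>t. f t = fbar")
    case True
    then obtain t0 where t0: "f t0 = fbar" ..
    have eq: "f t = fbar" if "t \<ge> t0" for t
      using \<open>decseq f\<close> f_ge[of t] t0 that by (metis antisym decseqD)
    have stay: "z (Suc t) = z t" if "t \<ge> t0" for t
      using descent'[of t] eq[of t] eq[of "Suc t"] that c
      by (simp add: d_def mult_le_0_iff)
    have "z t = z t0" if "t \<ge> t0" for t
      using that by (induction t rule: dec_induct) (auto simp: stay)
    then have "z \<longlonglongrightarrow> z t0"
      by (intro tendsto_eventually eventually_sequentiallyI)
    moreover from this have "z t0 = zbar"
      using r LIMSEQ_subseq_LIMSEQ LIMSEQ_unique by blast
    ultimately show ?thesis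
      by simp
  next
    case False
    define e where "e t = f t - fbar" for t
    have e_pos: "e t > 0" for t
      using False f_ge[of t] by (auto simp: e_def less_le)
    have e_lim: "e \<longlonglongrightarrow> 0"
      unfolding e_def using lim by (simp add: LIM_zero)
    obtain \<eta> U \<kappa> \<kappa>' where "\<eta> > 0" and U: "open U" "zbar \<in> U"
      and conc: "concave_on {0..<\<eta>} \<kappa>" and cont: "continuous_on {0..<\<eta>} \<kappa>" and \<kappa>0: "\<kappa> 0 = 0"
      and der: "\<forall>s\<in>{0<..<\<eta>}. (\<kappa> has_real_derivative \<kappa>' s) (at s) \<and> \<kappa>' s > 0"
      and KL_ineq: "\<forall>z\<in>U. \<Psi> zbar < \<Psi> z \<and> \<Psi> z < \<Psi> zbar + ereal \<eta> \<longrightarrow>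
          (\<forall>v\<in>limiting_subdiff \<Psi> z. 1 \<le> \<kappa>' (real_of_ereal (\<Psi> z - \<Psi> zbar)) * norm v)"
      using KL unfolding KL_at_def by (elim exE conjE) (rule that)
    obtain \<rho> where \<rho>: "\<rho> > 0" "ball zbar \<rho> \<subseteq> U"
      using U openE by blast
    obtain N0 where N0: "e t < \<eta>" if "t \<ge> N0" for t
      using order_tendstoD(2)[OF e_lim \<open>\<eta> > 0\<close>] by (auto simp: eventually_sequentially)
    define M where "M = K / c"
    have M: "M \<ge> 0"
      using K c by (simp add: M_def)
    \<comment> \<open>The truncated \<open>t - 1\<close> differs from the predecessor only at
      \<open>t = 0\<close>; the potential inequality starts at \<open>Suc N0\<close>.\<close>
    define P where "P t = d (t - 1) + M * \<kappa> (e t)" for t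
    have \<kappa>_nonneg: "\<kappa> (e t) \<ge> 0" if "t \<ge> N0" for t
    proof -
      have s: "e t \<in> {0<..<\<eta>}"
        using e_pos N0 that by simp
      have "\<kappa> 0 \<le> \<kappa> (e t) + \<kappa>' (e t) * (0 - e t)"
        using \<open>\<eta> > 0\<close> bspec[OF der s] by (intro concave_on_le_tangent[OF conc s]) auto
      moreover have "\<kappa>' (e t) * e t > 0"
        using bspec[OF der s] e_pos by simp
      ultimately show ?thesis
        using \<kappa>0 by simp
    qed
    have P_nonneg: "P t \<ge> 0" if "t \<ge> N0" for t
      using \<kappa>_nonneg[OF that] M by (simp add: P_def d_def)
    have potential_step: "d t + P (Suc t) \<le> P t" if t: "t \<ge> Suc N0" and z_near: "z t \<in> ball zbar \<rho>" for t
    proof -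
      obtain t' where t': "t = Suc t'"
        using t by (cases t) auto
      have s: "e t \<in> {0<..<\<eta>}" "e (Suc t) \<in> {0..<\<eta>}"
        using e_pos N0[of t] N0[of "Suc t"] t by (auto simp: less_imp_le)
      have \<kappa>': "\<kappa>' (e t) > 0"
        using der s by blast
      have "1 \<le> \<kappa>' (real_of_ereal (\<Psi> (z t) - \<Psi> zbar)) * norm (w t)"
        using z_near \<rho> s by (intro KL_ineq[rule_format] w) (auto simp: \<Psi>_z \<Psi>_zbar e_def)
      then have "1 \<le> \<kappa>' (e t) * norm (w t)"
        by (simp add: \<Psi>_z \<Psi>_zbar e_def)
      also have "\<dots> \<le> \<kappa>' (e t) * (K * d t')"
        using w_le[of t'] \<kappa>' by (intro mult_left_mono) (auto simp: t' d_def)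
      finally have one_le: "1 \<le> \<kappa>' (e t) * (K * d t')" .
      define \<delta> where "\<delta> = \<kappa> (e t) - \<kappa> (e (Suc t))"
      have "\<kappa>' (e t) * (c * (d t)\<^sup>2) \<le> \<kappa>' (e t) * (e t - e (Suc t))"
        using descent'[of t] \<kappa>' by (intro mult_left_mono) (auto simp: e_def)
      also have "\<dots> \<le> \<delta>"
        using concave_on_le_tangent[OF conc s conjunct1[OF bspec[OF der s(1)]]]
        by (simp add: \<delta>_def algebra_simps)
      finally have \<delta>: "\<kappa>' (e t) * (c * (d t)\<^sup>2) \<le> \<delta>" .
      \<comment> \<open>Inserting a factor that is at least 1 lets the unknown slope
        \<open>\<kappa>' (e t)\<close> be absorbed into the drop \<open>\<delta>\<close> of
        \<open>\<kappa>\<close>.\<close>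
      have "c * (d t)\<^sup>2 * 1 \<le> c * (d t)\<^sup>2 * (\<kappa>' (e t) * (K * d t'))"
        using one_le c by (intro mult_left_mono) auto
      also have "\<dots> = (\<kappa>' (e t) * (c * (d t)\<^sup>2)) * (K * d t')"
        by simp
      also have "\<dots> \<le> \<delta> * (K * d t')"
        using \<delta> K by (intro mult_right_mono) (auto simp: d_def)
      finally have le: "(d t)\<^sup>2 \<le> d t' * (M * \<delta>)"
        using c by (simp add: M_def field_simps)
      have "0 \<le> \<kappa>' (e t) * (c * (d t)\<^sup>2)"
        using \<kappa>' c by simp
      then have "M * \<delta> \<ge> 0"
        using \<delta> M by simp
      \<comment> \<open>AM-GM in the form \<open>4 * u * v \<le> (u + v)\<^sup>2\<close> with
        \<open>u = d t'\<close> and \<open>v = M * \<delta>\<close>. Of the two copies of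
        \<open>d t\<close> obtained, one enters \<open>P (Suc t)\<close> and the other is the step
        gained.\<close>
      then have "(2 * d t)\<^sup>2 \<le> (d t' + M * \<delta>)\<^sup>2"
        using le sum_squares_bound[of "d t'" "M * \<delta>"]
        by (simp add: power2_eq_square algebra_simps)
      then have "2 * d t \<le> d t' + M * \<delta>"
        by (rule power2_le_imp_le) (use \<open>M * \<delta> \<ge> 0\<close> in \<open>simp add: d_def\<close>)
      then show ?thesis
        by (simp add: P_def t' \<delta>_def algebra_simps)
    qed
    \<comment> \<open>As \<open>P\<close> is nonnegative, the invariant keeps \<open>z t\<close> in
      the ball, which is what the next potential step requires; the triangle inequality then renews
      the invariant.\<close>
    have trap: "dist (z t) zbar + P t \<le> dist (z N) zbar + P N"
      if N: "N \<ge> Suc N0" "dist (z N) zbar + P N < \<rho>" and "t \<ge> N" for N t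
      using \<open>t \<ge> N\<close>
    proof (induction t rule: dec_induct)
      case (step t)
      have "dist (z t) zbar < \<rho>"
        using step.IH N P_nonneg[of t] step.hyps by linarith
      then have "d t + P (Suc t) \<le> P t"
        using N step.hyps by (intro potential_step) (auto simp: dist_commute)
      then show ?case
        using step.IH dist_triangle[of "z (Suc t)" zbar "z t"] by (simp add: d_def)
    qed simp
    have d_lim: "d \<longlonglongrightarrow> 0"
    proof -
      have "(\<lambda>t. (f t - f (Suc t)) / c) \<longlonglongrightarrow> (fbar - fbar) / c"
        using c lim LIMSEQ_Suc[OF lim] by (intro tendsto_intros) auto
      then have lim0: "(\<lambda>t. (f t - f (Suc t)) / c) \<longlonglongrightarrow> 0"
        by simp
      have "(\<lambda>t. (d t)\<^sup>2) \<longlonglongrightarrow> 0"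
        by (rule tendsto_sandwich[OF _ _ tendsto_const lim0])
          (use descent' c in \<open>auto simp: field_simps\<close>)
      then have "(\<lambda>t. sqrt ((d t)\<^sup>2)) \<longlonglongrightarrow> sqrt 0"
        by (rule tendsto_real_sqrt)
      then show ?thesis
        by (simp add: d_def[abs_def])
    qed
    have P_lim: "P \<longlonglongrightarrow> 0"
    proof -
      have "(\<lambda>t. \<kappa> (e t)) \<longlonglongrightarrow> \<kappa> 0"
        by (rule continuous_on_tendsto_compose[OF cont e_lim])
          (use \<open>\<eta> > 0\<close> N0 e_pos in \<open>auto intro!: eventually_sequentiallyI[of N0] simp: less_imp_le\<close>)
      moreover have "(\<lambda>t. d (t - 1)) \<longlonglongrightarrow> 0"
        using d_lim by (subst filterlim_sequentially_Suc[symmetric]) simp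
      ultimately have "P \<longlonglongrightarrow> 0 + M * \<kappa> 0"
        unfolding P_def by (intro tendsto_intros)
      then show ?thesis
        using \<kappa>0 by simp
    qed
    have subseq_lim: "(\<lambda>k. dist (z (r k)) zbar + P (r k)) \<longlonglongrightarrow> 0"
      using tendsto_add[OF tendsto_dist[OF r(2) tendsto_const[of zbar]] LIMSEQ_subseq_LIMSEQ[OF P_lim r(1)]]
      by (simp add: o_def)
    show ?thesis
    proof (rule tendstoI)
      fix \<epsilon> :: real
      assume "\<epsilon> > 0"
      \<comment> \<open>Below \<open>\<rho>\<close> the trap applies, below
        \<open>\<epsilon>\<close> it gives the conclusion; the bound on \<open>k\<close> passes to
        \<open>r k\<close> because \<open>r k \<ge> k\<close>.\<close>
      then have "\<forall>\<^sub>F k in sequentially. dist (z (r k)) zbar + P (r k) < min \<epsilon> \<rho> \<and> k \<ge> Suc N0"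
        using \<rho> order_tendstoD(2)[OF subseq_lim, of "min \<epsilon> \<rho>"]
        by (intro eventually_conj eventually_ge_at_top) auto
      then obtain k where k: "dist (z (r k)) zbar + P (r k) < min \<epsilon> \<rho>" "k \<ge> Suc N0"
        using eventually_happens'[OF sequentially_bot] by blast
      have N: "r k \<ge> Suc N0"
        using k seq_suble[OF r(1), of k] by simp
      have "dist (z t) zbar < \<epsilon>" if "t \<ge> r k" for t
        using trap[OF N _ that] k(1) P_nonneg[of t] N that by simp
      then show "\<forall>\<^sub>F t in sequentially. dist (z t) zbar < \<epsilon>"
        by (intro eventually_sequentiallyI)
    qed
  qed
qed

text \<open>The minimum is below each of the \<open>T - 1\<close> values \<open>S (Suc t)\<close>,
  so \<open>T - 1\<close> times its square is at most \<open>K\<^sup>2 * B\<close>. The value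
  \<open>S 0\<close> precedes every step and is left out of this count.\<close>

lemma Min_bigo_inverse_sqrt:
  fixes S d :: "nat \<Rightarrow> real"
  assumes S: "\<And>t. S t \<ge> 0" and S_le: "\<And>t. S (Suc t) \<le> K * d t"
    and sum_le: "\<And>T. (\<Sum>t<T. (d t)\<^sup>2) \<le> B"
  shows "(\<lambda>T. Min (S ` {0..<T})) \<in> O(\<lambda>T. 1 / sqrt (real T))"
proof (rule bigoI)
  show "\<forall>\<^sub>F T in sequentially.
      norm (Min (S ` {0..<T})) \<le> sqrt (2 * (K\<^sup>2 * B)) * norm (1 / sqrt (real T))"
    \<comment> \<open>For \<open>T \<ge> 2\<close> the shifted count satisfies
      \<open>T \<le> 2 * (T - 1)\<close>, hence the factor 2 in the constant.\<close>
    using eventually_ge_at_top[of 2]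
  proof eventually_elim
    case (elim T)
    define m where "m = Min (S ` {0..<T})"
    obtain T' where T': "T = Suc T'" "T' \<ge> 1"
      using elim by (cases T) auto
    have "m \<in> S ` {0..<T}"
      unfolding m_def using elim by (intro Min_in) auto
    then have m: "m \<ge> 0"
      using S by auto
    have "real T' * m\<^sup>2 = (\<Sum>t<T'. m\<^sup>2)"
      by simp
    also have "\<dots> \<le> (\<Sum>t<T'. K\<^sup>2 * (d t)\<^sup>2)"
    proof (rule sum_mono)
      fix t
      assume "t \<in> {..<T'}"
      then have "m \<le> S (Suc t)"
        unfolding m_def using T' by (intro Min_le) auto
      also note S_le[of t]
      finally show "m\<^sup>2 \<le> K\<^sup>2 * (d t)\<^sup>2"
        using m by (simp flip: power_mult_distrib add: power_mono)
    qed
    also have "\<dots> \<le> K\<^sup>2 * B"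
      using sum_le[of T'] by (simp flip: sum_distrib_left add: mult_left_mono)
    finally have "real T' * m\<^sup>2 \<le> K\<^sup>2 * B" .
    moreover have "real T * m\<^sup>2 \<le> 2 * (real T' * m\<^sup>2)"
      unfolding mult.assoc[symmetric] using T' by (intro mult_right_mono) auto
    ultimately have "real T * m\<^sup>2 \<le> 2 * (K\<^sup>2 * B)"
      by linarith
    then have "sqrt (real T * m\<^sup>2) \<le> sqrt (2 * (K\<^sup>2 * B))"
      by (rule real_sqrt_le_mono)
    then show ?case
      using m elim by (simp add: real_sqrt_mult field_simps flip: m_def)
  qed
qed

section \<open>Products of spheres\<close>

lemma tangent_proj_diff: "tangent_proj a (v - w) = tangent_proj a v - tangent_proj a w"
  by (simp add: tangent_proj_def inner_diff_right algebra_simps)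

lemma tangent_proj_scaleR: "tangent_proj a (r *\<^sub>R v) = r *\<^sub>R tangent_proj a v"
  by (simp add: tangent_proj_def algebra_simps)

lemma norm_tangent_proj_le:
  assumes "norm a = 1"
  shows "norm (tangent_proj a v) \<le> norm v"
proof -
  have "a \<bullet> a = 1"
    using assms by (simp add: dot_square_norm)
  then have "(norm (tangent_proj a v))\<^sup>2 = (norm v)\<^sup>2 - (a \<bullet> v)\<^sup>2"
    unfolding power2_norm_eq_inner tangent_proj_def
    by (simp add: inner_diff_left inner_diff_right inner_commute power2_eq_square algebra_simps)
  then have "(norm (tangent_proj a v))\<^sup>2 \<le> (norm v)\<^sup>2"
    by simp
  then show ?thesis
    by (rule power2_le_imp_le) simp
qed

lemma tangent_proj_self:
  assumes "norm a = 1"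
  shows "tangent_proj a (r *\<^sub>R a) = 0"
  using assms by (simp add: tangent_proj_def dot_square_norm)

text \<open>Both sides equal \<open>a \<bullet> q - 1\<close>. A chord of the sphere is thus tangent
  up to second order, which serves both the projected step and the subgradient estimate.\<close>

lemma inner_unit_diff:
  fixes a q :: "'a::real_inner"
  assumes "norm a = 1" "norm q = 1"
  shows "a \<bullet> (q - a) = - (norm (q - a))\<^sup>2 / 2"
proof -
  have "a \<bullet> a = 1" "q \<bullet> q = 1"
    using assms by (simp_all add: dot_square_norm)
  then show ?thesis
    by (simp add: power2_norm_eq_inner inner_diff_left inner_diff_right inner_commute)
qed

text \<open>Since \<open>1 / 0 = 0\<close>, \<open>projA\<close> sends a zero column to zero.
  Membership of the result in the constraint set excludes this case and makes the scale
  \<open>norm (v $ j)\<close> positive.\<close>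

lemma projA_eq_scaled:
  assumes "projA v \<in> constraint_set"
  obtains s where "s > 0" "v $ j = s *\<^sub>R projA v $ j"
proof
  have "norm (projA v $ j) = 1"
    using assms by (simp add: constraint_set_def)
  then show "norm (v $ j) > 0" "v $ j = norm (v $ j) *\<^sub>R projA v $ j"
    by (auto simp: projA_def split: if_splits)
qed

text \<open>Columnwise \<open>\<gamma> *\<^sub>R G $ j = a $ j - s *\<^sub>R q $ j\<close> with
  \<open>s > 0\<close>, so the pairing is \<open>- (1 + s) / 2\<close> times the squared column
  step. Keeping only the half is what leads to the threshold \<open>1 / L\<close> for the
  \<alpha>-step.\<close>

lemma inner_projA_step_le:
  assumes a: "a \<in> constraint_set" and q: "q \<in> constraint_set"
    and q_def: "q = projA (a - \<gamma> *\<^sub>R G)"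
  shows "\<gamma> * (G \<bullet> (q - a)) \<le> - (norm (q - a))\<^sup>2 / 2"
proof -
  have "\<gamma> * (G $ j \<bullet> (q $ j - a $ j)) \<le> - (norm (q $ j - a $ j))\<^sup>2 / 2" for j
  proof -
    obtain s where s: "s > 0" "(a - \<gamma> *\<^sub>R G) $ j = s *\<^sub>R projA (a - \<gamma> *\<^sub>R G) $ j"
      using projA_eq_scaled q q_def by metis
    then have G: "\<gamma> *\<^sub>R G $ j = a $ j - s *\<^sub>R q $ j"
      by (simp add: q_def algebra_simps)
    have n: "norm (a $ j) = 1" "norm (q $ j) = 1"
      using a q by (auto simp: constraint_set_def)
    have "\<gamma> * (G $ j \<bullet> (q $ j - a $ j)) = (a $ j - s *\<^sub>R q $ j) \<bullet> (q $ j - a $ j)"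
      by (simp flip: G)
    also have "\<dots> = a $ j \<bullet> (q $ j - a $ j) + s * (q $ j \<bullet> (a $ j - q $ j))"
      by (simp add: inner_diff_left inner_diff_right algebra_simps)
    also have "\<dots> = - (norm (q $ j - a $ j))\<^sup>2 / 2 - s * ((norm (q $ j - a $ j))\<^sup>2 / 2)"
      using inner_unit_diff[OF n] inner_unit_diff[OF n(2,1)] by (simp add: norm_minus_commute)
    also have "\<dots> \<le> - (norm (q $ j - a $ j))\<^sup>2 / 2"
      using s by simp
    finally show ?thesis .
  qed
  then have "(\<Sum>j\<in>UNIV. \<gamma> * (G $ j \<bullet> (q $ j - a $ j)))
      \<le> (\<Sum>j\<in>UNIV. - (norm (q $ j - a $ j))\<^sup>2 / 2)"
    by (intro sum_mono)
  then show ?thesis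
    by (simp add: inner_vec_def power2_norm_eq_inner sum_distrib_left sum_negf sum_divide_distrib)
qed

text \<open>Up to a multiple of \<open>q $ j\<close>, which the tangential projection at
  \<open>q $ j\<close> annihilates, \<open>\<gamma> *\<^sub>R G $ j\<close> is the column step
  \<open>a $ j - q $ j\<close>.\<close>

lemma norm_tangent_proj_projA_step_le:
  assumes q: "q \<in> constraint_set" and q_def: "q = projA (a - \<gamma> *\<^sub>R G)" and "\<gamma> > 0"
  shows "norm (tangent_proj (q $ j) (G $ j)) \<le> norm (q - a) / \<gamma>"
proof -
  obtain s where s: "(a - \<gamma> *\<^sub>R G) $ j = s *\<^sub>R projA (a - \<gamma> *\<^sub>R G) $ j"
    using projA_eq_scaled q q_def by metis
  have n: "norm (q $ j) = 1"
    using q by (auto simp: constraint_set_def)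
  have "\<gamma> *\<^sub>R G $ j = (a $ j - q $ j) - (s - 1) *\<^sub>R q $ j"
    using s by (simp add: q_def algebra_simps)
  then have "\<gamma> *\<^sub>R tangent_proj (q $ j) (G $ j) = tangent_proj (q $ j) (a $ j - q $ j)"
    using tangent_proj_self[OF n, of "s - 1"]
    by (simp flip: tangent_proj_scaleR add: tangent_proj_diff)
  then have "\<gamma> * norm (tangent_proj (q $ j) (G $ j)) = norm (tangent_proj (q $ j) (a $ j - q $ j))"
    using \<open>\<gamma> > 0\<close> by (metis abs_of_pos norm_scaleR)
  also have "\<dots> \<le> norm ((a - q) $ j)"
    using norm_tangent_proj_le[OF n] by simp
  also have "\<dots> \<le> norm (q - a)"
    by (metis Finite_Cartesian_Product.norm_nth_le norm_minus_commute)
  finally show ?thesis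
    using \<open>\<gamma> > 0\<close> by (simp add: field_simps)
qed

section \<open>Riemannian gradients as subgradients of \<open>Psi\<close>\<close>

definition riem_grad :: "(('d::finite,'m::finite,'k::finite) param \<Rightarrow> real)
    \<Rightarrow> ('d,'m,'k) param \<Rightarrow> ('d,'m,'k) param" where
  "riem_grad F p = (\<chi> j. tangent_proj (fst p $ j) (grad_alpha F p $ j), grad_beta F p)"

definition stationarity_gap :: "(('d::finite,'m::finite,'k::finite) param \<Rightarrow> real)
    \<Rightarrow> ('d,'m,'k) param \<Rightarrow> real" where
  "stationarity_gap F p =
     (\<Sum>j\<in>UNIV. norm (tangent_proj (fst p $ j) (grad_alpha F p $ j))) + norm (grad_beta F p)"

lemma stationarity_gap_nonneg: "stationarity_gap F p \<ge> 0"
  by (simp add: stationarity_gap_def sum_nonneg)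

lemma stationary_iff_gap_eq_0: "stationary F p \<longleftrightarrow> stationarity_gap F p = 0"
  by (auto simp: stationary_def stationarity_gap_def add_nonneg_eq_0_iff sum_nonneg
      sum_nonneg_eq_0_iff)

text \<open>Links the Euclidean norm in the KL inequality to the sum of column norms in the
  rate.\<close>

lemma norm_riem_grad_le: "norm (riem_grad F p) \<le> stationarity_gap F p"
proof -
  have "norm (riem_grad F p) \<le> norm (fst (riem_grad F p)) + norm (snd (riem_grad F p))"
    by (metis norm_Pair_le prod.collapse)
  also have "\<dots> \<le> stationarity_gap F p"
    by (auto simp: riem_grad_def stationarity_gap_def norm_vec_def intro!: L2_set_le_sum)
  finally show ?thesis .
qed

text \<open>On the constraint set the normal part of the gradient is paired with \<open>q - p\<close> only to second
  order, because \<open>a\<^sub>j \<bullet> (q\<^sub>j - a\<^sub>j) = - \<bar>q\<^sub>j - a\<^sub>j\<bar>\<^sup>2 / 2\<close> for unit vectors.\<close>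

lemma riem_grad_in_frechet_subdiff:
  fixes F :: "('d::finite,'m::finite,'k::finite) param \<Rightarrow> real"
  assumes diff: "F differentiable (at p)" and p: "fst p \<in> constraint_set"
  shows "riem_grad F p \<in> frechet_subdiff (Psi F) p"
proof -
  \<comment> \<open>\<open>l j\<close> is the normal component of the gradient in column
    \<open>j\<close>, the multiplier of the constraint on that column.\<close>
  define l where "l j = fst p $ j \<bullet> grad_alpha F p $ j" for j
  define M where "M = (\<Sum>j\<in>UNIV. \<bar>l j\<bar>) / 2"
  have normal_part: "(riem_grad F p - grad F p) \<bullet> (q - p) \<le> M * (norm (q - p))\<^sup>2"
    if q: "fst q \<in> constraint_set" for q
  proof -
    have "(riem_grad F p - grad F p) \<bullet> (q - p)
        = (\<Sum>j\<in>UNIV. - l j * (fst p $ j \<bullet> (fst q $ j - fst p $ j)))"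
      unfolding inner_prod_def
      by (subst inner_vec_def)
        (simp add: riem_grad_def grad_alpha_def grad_beta_def tangent_proj_def l_def)
    also have "\<dots> = (\<Sum>j\<in>UNIV. l j * (norm (fst q $ j - fst p $ j))\<^sup>2 / 2)"
      using p q by (simp add: inner_unit_diff constraint_set_def)
    also have "\<dots> \<le> (\<Sum>j\<in>UNIV. \<bar>l j\<bar> * (norm (q - p))\<^sup>2 / 2)"
    proof (intro sum_mono divide_right_mono mult_mono power_mono)
      fix j
      have "norm ((fst (q - p)) $ j) \<le> norm (fst (q - p))"
        by (rule Finite_Cartesian_Product.norm_nth_le)
      also have "\<dots> \<le> norm (q - p)"
        by (metis norm_fst_le prod.collapse)
      finally show "norm (fst q $ j - fst p $ j) \<le> norm (q - p)"
        by simp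
    qed auto
    also have "\<dots> = M * (norm (q - p))\<^sup>2"
      by (simp add: M_def sum_distrib_right sum_divide_distrib)
    finally show ?thesis .
  qed
  have M: "M \<ge> 0"
    by (simp add: M_def sum_nonneg)
  have "\<forall>\<^sub>F q in at p. Psi F p + ereal (riem_grad F p \<bullet> (q - p) - \<epsilon> * norm (q - p)) \<le> Psi F q"
    if \<epsilon>: "\<epsilon> > 0" for \<epsilon>
  proof -
    have "\<exists>\<delta>>0. \<forall>q. norm (q - p) < \<delta> \<longrightarrow>
        norm (F q - F p - (q - p) \<bullet> grad F p) \<le> (\<epsilon> / 2) * norm (q - p)"
      using GDERIV_grad[OF diff] \<epsilon> unfolding gderiv_def has_derivative_at_alt
      by (meson half_gt_zero)
    then obtain \<delta> where \<delta>: "\<delta> > 0" and lin: "\<And>q. norm (q - p) < \<delta> \<Longrightarrow>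
        norm (F q - F p - (q - p) \<bullet> grad F p) \<le> (\<epsilon> / 2) * norm (q - p)"
      by blast
    \<comment> \<open>The error budget \<open>\<epsilon>\<close> is halved: radius
      \<open>\<delta>\<close> controls the linearization, the other radius the second-order normal
      part. Using \<open>M + 1\<close> avoids division by zero. Off the constraint set
      \<open>Psi F q\<close> is infinite.\<close>
    define \<rho> where "\<rho> = min \<delta> (\<epsilon> / (2 * (M + 1)))"
    have "\<rho> > 0"
      using \<delta> \<epsilon> M by (simp add: \<rho>_def)
    then have "\<forall>\<^sub>F q in at p. dist q p < \<rho>"
      using eventually_at by blast
    then show ?thesis
    proof eventually_elim
      case (elim q)
      show ?case
      proof (cases "fst q \<in> constraint_set")
        case True
        have "M * norm (q - p) \<le> (M + 1) * (\<epsilon> / (2 * (M + 1)))"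
          using elim M \<epsilon> by (intro mult_mono) (auto simp: \<rho>_def dist_norm)
        also have "\<dots> = \<epsilon> / 2"
          using M by (simp add: field_simps)
        finally have "M * norm (q - p) \<le> \<epsilon> / 2" .
        then have "M * (norm (q - p))\<^sup>2 \<le> \<epsilon> / 2 * norm (q - p)"
          unfolding power2_eq_square mult.assoc[symmetric] by (rule mult_right_mono) simp
        then have "(riem_grad F p - grad F p) \<bullet> (q - p) \<le> \<epsilon> / 2 * norm (q - p)"
          using normal_part[OF True] by linarith
        moreover have "\<bar>F q - F p - grad F p \<bullet> (q - p)\<bar> \<le> \<epsilon> / 2 * norm (q - p)"
          using lin[of q] elim by (simp add: \<rho>_def dist_norm inner_commute)
        ultimately have "F p + (riem_grad F p \<bullet> (q - p) - \<epsilon> * norm (q - p)) \<le> F q"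
          unfolding inner_diff_left by linarith
        then show ?thesis
          using True p by (simp add: Psi_def)
      qed (simp add: Psi_def)
    qed
  qed
  then show ?thesis
    using p by (simp add: frechet_subdiff_def Psi_def)
qed

lemma frechet_subdiff_subset_limiting: "frechet_subdiff \<Psi> z \<subseteq> limiting_subdiff \<Psi> z"
proof
  fix v
  assume "v \<in> frechet_subdiff \<Psi> z"
  then show "v \<in> limiting_subdiff \<Psi> z"
    unfolding limiting_subdiff_def
    by (intro CollectI exI[of _ "\<lambda>_. z"] exI[of _ "\<lambda>_. v"]) simp
qed

section \<open>The variational inequality field is a gradient\<close>

lemma GDERIV_gaim:
  fixes p :: "('d::finite,'m::finite,'k::finite) param"
  assumes "\<And>k. \<phi> k differentiable_on UNIV"
  shows "GDERIV (\<lambda>p. gaim \<phi> x (fst p) (snd p)) p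
    :> (grad_alpha_f \<phi> x (fst p) (snd p), Phi \<phi> x (fst p))"
proof -
  have \<phi>: "(\<phi> k has_real_derivative deriv (\<phi> k) s) (at s)" for k s
    using assms[of k]
    by (metis DERIV_deriv_iff_real_differentiable differentiable_on_def UNIV_I)
  have ridge: "((\<lambda>p::('d,'m,'k) param. \<phi> k (fst p $ j \<bullet> x))
      has_derivative (\<lambda>h. (fst h $ j \<bullet> x) * deriv (\<phi> k) (fst p $ j \<bullet> x))) (at p)" for j k
  proof -
    have "((\<lambda>p::('d,'m,'k) param. fst p $ j \<bullet> x) has_derivative (\<lambda>h. fst h $ j \<bullet> x)) (at p)"
      by (auto intro!: derivative_eq_intros bounded_linear.has_derivative[OF bounded_linear_vec_nth])
    from has_derivative_compose[OF this has_field_derivative_imp_has_derivative[OF \<phi>]]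
    show ?thesis
      by (simp add: mult.commute)
  qed
  have coeff: "((\<lambda>p::('d,'m,'k) param. snd p $ j $ k) has_derivative (\<lambda>h. snd h $ j $ k)) (at p)" for j k
    by (auto intro!: derivative_eq_intros bounded_linear.has_derivative[OF bounded_linear_vec_nth])
  have "((\<lambda>p. gaim \<phi> x (fst p) (snd p)) has_derivative
      (\<lambda>h. \<Sum>j\<in>UNIV. \<Sum>k\<in>UNIV. snd p $ j $ k * ((fst h $ j \<bullet> x) * deriv (\<phi> k) (fst p $ j \<bullet> x))
         + snd h $ j $ k * \<phi> k (fst p $ j \<bullet> x))) (at p)"
    unfolding gaim_def by (intro has_derivative_sum has_derivative_mult ridge coeff)
  moreover have "fst h \<bullet> grad_alpha_f \<phi> x (fst p) (snd p)
      = (\<Sum>j\<in>UNIV. \<Sum>k\<in>UNIV. snd p $ j $ k * ((fst h $ j \<bullet> x) * deriv (\<phi> k) (fst p $ j \<bullet> x)))"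
    for h :: "('d,'m,'k) param"
    by (subst inner_vec_def)
      (simp add: grad_alpha_f_def sum_distrib_left mult_ac)
  moreover have "snd h \<bullet> Phi \<phi> x (fst p)
      = (\<Sum>j\<in>UNIV. \<Sum>k\<in>UNIV. snd h $ j $ k * \<phi> k (fst p $ j \<bullet> x))"
    for h :: "('d,'m,'k) param"
    by (subst inner_vec_def, subst inner_vec_def) (simp add: Phi_def)
  ultimately show ?thesis
    by (simp add: gderiv_def inner_prod_def sum.distrib)
qed

lemma has_real_derivative_interval_integral:
  fixes f :: "real \<Rightarrow> real"
  assumes "continuous_on UNIV f"
  shows "((\<lambda>u. LBINT s=ereal 0..ereal u. f s) has_real_derivative f u) (at u)"
proof -
  \<comment> \<open>The fundamental theorem is stated within a compact interval. The margin 1 puts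
    \<open>u\<close> in its interior, for either sign of \<open>u\<close>, so the derivative becomes
    two-sided.\<close>
  define A where "A = {min 0 u - 1..max 0 u + 1}"
  have "((\<lambda>u. LBINT s=ereal 0..ereal u. f s) has_vector_derivative f u) (at u within A)"
    unfolding A_def using assms
    by (intro interval_integral_FTC2) (auto intro: continuous_on_subset)
  moreover have "u \<in> interior A"
    by (auto simp: A_def)
  ultimately show ?thesis
    by (metis at_within_interior has_real_derivative_iff_has_vector_derivative)
qed

text \<open>Differentiating each integral in its upper limit gives the residual
  \<open>mu - y i\<close>, and the chain rule multiplies it by the gradient of the additive index
  function.\<close>

lemma grad_Qn:
  fixes p :: "('d::finite,'m::finite,'k::finite) param"
  assumes ginv: "continuous_on UNIV ginv" and \<phi>: "\<And>k. \<phi> k differentiable_on UNIV"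
  shows "grad (Qn ginv \<phi> n x y) p
    = (Valpha ginv \<phi> n x y (fst p) (snd p), Vbeta ginv \<phi> n x y (fst p) (snd p))"
proof (rule grad_eqI)
  let ?f = "\<lambda>i (p::('d,'m,'k) param). gaim \<phi> (x i) (fst p) (snd p)"
  let ?D = "\<lambda>i. (grad_alpha_f \<phi> (x i) (fst p) (snd p), Phi \<phi> (x i) (fst p))"
  have "GDERIV (\<lambda>p. LBINT s=ereal 0..ereal (?f i p). ginv s - y i) p
      :> (ginv (?f i p) - y i) *\<^sub>R ?D i" for i
    using ginv
    by (intro GDERIV_DERIV_compose[where g = "\<lambda>u. LBINT s=ereal 0..ereal u. ginv s - y i"]
        GDERIV_gaim \<phi> has_real_derivative_interval_integral continuous_intros)
  then have "(Qn ginv \<phi> n x y has_derivative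
      (\<lambda>h. (1 / real n) * (\<Sum>i<n. h \<bullet> ((ginv (?f i p) - y i) *\<^sub>R ?D i)))) (at p)"
    unfolding Qn_def gderiv_def by (intro has_derivative_mult_right has_derivative_sum)
  then have "GDERIV (Qn ginv \<phi> n x y) p :> (1 / real n) *\<^sub>R (\<Sum>i<n. (ginv (?f i p) - y i) *\<^sub>R ?D i)"
    by (simp add: gderiv_def inner_sum_right)
  moreover have "(1 / real n) *\<^sub>R (\<Sum>i<n. (ginv (?f i p) - y i) *\<^sub>R ?D i)
      = (Valpha ginv \<phi> n x y (fst p) (snd p), Vbeta ginv \<phi> n x y (fst p) (snd p))"
    by (simp add: prod_eq_iff fst_sum snd_sum Valpha_def Vbeta_def mu_def)
  ultimately show "GDERIV (Qn ginv \<phi> n x y) p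
      :> (Valpha ginv \<phi> n x y (fst p) (snd p), Vbeta ginv \<phi> n x y (fst p) (snd p))"
    by simp
qed

text \<open>Reduces VI to GD on the potential \<open>Qn\<close>, so that a single analysis covers
  both algorithms.\<close>

lemma VI_iter_imp_GD_iter:
  assumes "continuous_on UNIV ginv" "\<And>k. \<phi> k differentiable_on UNIV"
    and "VI_iter ginv \<phi> n x y ga gb a b"
  shows "GD_iter (Qn ginv \<phi> n x y) ga gb a b"
  using assms(3)
  by (simp add: VI_iter_def GD_iter_def alt_iter_def grad_alpha_def grad_beta_def grad_Qn[OF assms(1,2)])

section \<open>The alternating scheme\<close>

text \<open>Closedness of \<open>C\<close> places limit points in \<open>U\<close>, where the
  gradient is continuous; \<open>\<Omega>\<close> keeps them on the spheres and bounds
  \<open>F\<close> from below.\<close>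

locale projected_alternating_descent =
  fixes F :: "('d::finite,'m::finite,'k::finite) param \<Rightarrow> real"
    and a :: "nat \<Rightarrow> real^'d^'m" and b :: "nat \<Rightarrow> real^'k^'m"
    and ga gb :: "nat \<Rightarrow> real"
    and \<Omega> U C :: "('d,'m,'k) param set"
    and L ga_lo ga_hi gb_lo gb_hi :: real
  assumes iter: "GD_iter F ga gb a b"
    and \<Omega>: "\<Omega> \<subseteq> constraint_set \<times> UNIV" "\<And>t. (a t, b t) \<in> \<Omega>" "compact \<Omega>"
    and bdd: "bdd_below (F ` \<Omega>)"
    and U: "open U" and C: "closed C" "C \<subseteq> U" "\<And>t. (a t, b t) \<in> C"
    and segment_b: "\<And>t. closed_segment (a t, b t) (a t, b (Suc t)) \<subseteq> C"
    and segment_a: "\<And>t. closed_segment (a t, b (Suc t)) (a (Suc t), b (Suc t)) \<subseteq> C"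
    and diff: "\<And>p. p \<in> U \<Longrightarrow> F differentiable (at p)"
    and lip: "\<And>p q. p \<in> U \<Longrightarrow> q \<in> U \<Longrightarrow> norm (grad F p - grad F q) \<le> L * dist p q"
    and L_pos: "L > 0"
    and gb: "0 < gb_lo" "\<And>t. gb_lo \<le> gb t" "\<And>t. gb t \<le> gb_hi" "gb_hi < 2 / L"
    and ga: "0 < ga_lo" "\<And>t. ga_lo \<le> ga t" "\<And>t. ga t \<le> ga_hi" "ga_hi < 1 / L"
begin

abbreviation z :: "nat \<Rightarrow> ('d,'m,'k) param" where
  "z t \<equiv> (a t, b t)"

text \<open>The smaller of the two block decrease rates at the largest admissible step sizes; the
  upper step bounds make it positive.\<close>

definition c :: real where
  "c = min (1 / gb_hi - L / 2) (1 / (2 * ga_hi) - L / 2)"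

text \<open>One term \<open>1 / ga_lo + L\<close> for each column and one term for \<beta>: the
  reciprocal step turns a displacement into a gradient, and \<open>L\<close> pays for moving the
  evaluation point.\<close>

definition K :: real where
  "K = real CARD('m) * (1 / ga_lo + L) + (1 / gb_lo + L)"

lemma b_Suc: "b (Suc t) = b t - gb t *\<^sub>R grad_beta F (z t)"
  and a_Suc: "a (Suc t) = projA (a t - ga t *\<^sub>R grad_alpha F (a t, b (Suc t)))"
  using iter by (auto simp: GD_iter_def alt_iter_def)

lemma a_in: "a t \<in> constraint_set"
  using \<Omega>(1) \<Omega>(2)[of t] by auto

lemma gb_pos: "gb t > 0" and ga_pos: "ga t > 0"
  using gb(1) gb(2)[of t] ga(1) ga(2)[of t] by auto

lemma c_pos: "c > 0"
proof -
  have "gb_hi > 0" "ga_hi > 0"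
    using gb(3)[of 0] gb_pos[of 0] ga(3)[of 0] ga_pos[of 0] by auto
  then show ?thesis
    using gb(4) ga(4) L_pos by (simp add: c_def field_simps)
qed

lemma K_nonneg: "K \<ge> 0"
  using L_pos ga(1) gb(1) by (simp add: K_def)

lemma mid_in_C: "(a t, b (Suc t)) \<in> C"
  using segment_b[of t] by auto

lemma C_in_U: "p \<in> C \<Longrightarrow> p \<in> U"
  using C(2) by auto

section \<open>Decrease of the objective in one iteration\<close>

lemma segment_descent:
  assumes "closed_segment p q \<subseteq> C"
  shows "F q \<le> F p + grad F p \<bullet> (q - p) + L / 2 * (norm (q - p))\<^sup>2"
proof (rule descent_lemma)
  fix u
  assume u: "u \<in> closed_segment p q"
  have "u \<in> U" "p \<in> U"
    using u assms C_in_U ends_in_segment(1) by blast+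
  then show "GDERIV F u :> grad F u" "norm (grad F u - grad F p) \<le> L * dist u p"
    by (blast intro: GDERIV_grad diff lip)+
qed

text \<open>Along an unconstrained gradient step the linear term is exactly
  \<open>- 1 / gb t\<close> times the squared step, whence the threshold
  \<open>2 / L\<close>.\<close>

lemma beta_descent: "F (a t, b (Suc t)) \<le> F (z t) - c * (norm (b (Suc t) - b t))\<^sup>2"
proof -
  define \<Delta> where "\<Delta> = b (Suc t) - b t"
  have "grad_beta F (z t) = (- 1 / gb t) *\<^sub>R \<Delta>"
    using gb_pos[of t] by (simp add: \<Delta>_def b_Suc)
  then have "grad F (z t) \<bullet> ((a t, b (Suc t)) - z t) = - (norm \<Delta>)\<^sup>2 / gb t"
    by (simp add: inner_prod_def grad_beta_def \<Delta>_def power2_norm_eq_inner)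
  moreover have "norm ((a t, b (Suc t)) - z t) = norm \<Delta>"
    by (simp add: \<Delta>_def norm_Pair)
  ultimately have "F (a t, b (Suc t)) \<le> F (z t) - (1 / gb t - L / 2) * (norm \<Delta>)\<^sup>2"
    using segment_descent[OF segment_b[of t]] by (simp add: algebra_simps)
  moreover have "c \<le> 1 / gb t - L / 2"
  proof -
    have "1 / gb_hi \<le> 1 / gb t"
      using gb(3)[of t] gb_pos[of t] by (intro divide_left_mono) auto
    then show ?thesis
      by (simp add: c_def)
  qed
  ultimately show ?thesis
    using mult_right_mono[of c "1 / gb t - L / 2" "(norm \<Delta>)\<^sup>2"] by (simp add: \<Delta>_def)
qed

lemma alpha_descent: "F (z (Suc t)) \<le> F (a t, b (Suc t)) - c * (norm (a (Suc t) - a t))\<^sup>2"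
proof -
  define \<Delta> where "\<Delta> = a (Suc t) - a t"
  have "grad F (a t, b (Suc t)) \<bullet> (z (Suc t) - (a t, b (Suc t)))
      = grad_alpha F (a t, b (Suc t)) \<bullet> \<Delta>"
    by (simp add: inner_prod_def grad_alpha_def \<Delta>_def)
  also have "\<dots> \<le> - (norm \<Delta>)\<^sup>2 / (2 * ga t)"
    using inner_projA_step_le[OF a_in a_in a_Suc] ga_pos[of t] by (simp add: \<Delta>_def field_simps)
  finally have "grad F (a t, b (Suc t)) \<bullet> (z (Suc t) - (a t, b (Suc t))) \<le> - (norm \<Delta>)\<^sup>2 / (2 * ga t)" .
  moreover have "norm (z (Suc t) - (a t, b (Suc t))) = norm \<Delta>"
    by (simp add: \<Delta>_def norm_Pair)
  ultimately have "F (z (Suc t)) \<le> F (a t, b (Suc t)) - (1 / (2 * ga t) - L / 2) * (norm \<Delta>)\<^sup>2"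
    using segment_descent[OF segment_a[of t]] by (simp add: algebra_simps)
  moreover have "c \<le> 1 / (2 * ga t) - L / 2"
  proof -
    have "1 / (2 * ga_hi) \<le> 1 / (2 * ga t)"
      using ga(3)[of t] ga_pos[of t] by (intro divide_left_mono) auto
    then show ?thesis
      by (simp add: c_def)
  qed
  ultimately show ?thesis
    using mult_right_mono[of c "1 / (2 * ga t) - L / 2" "(norm \<Delta>)\<^sup>2"] by (simp add: \<Delta>_def)
qed

text \<open>The two block steps are orthogonal in the product space, so their squared lengths add
  up.\<close>

lemma sufficient_decrease: "F (z (Suc t)) \<le> F (z t) - c * (dist (z (Suc t)) (z t))\<^sup>2"
proof -
  have "(dist (z (Suc t)) (z t))\<^sup>2 = (norm (a (Suc t) - a t))\<^sup>2 + (norm (b (Suc t) - b t))\<^sup>2"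
    by (simp add: dist_norm norm_Pair)
  then show ?thesis
    using beta_descent[of t] alpha_descent[of t] by (simp add: algebra_simps)
qed

text \<open>The \<alpha>-update uses the gradient at the half step \<open>(a t, b (Suc t))\<close>,
  the \<beta>-update the one at \<open>z t\<close>. Each is bounded by the displacement over the
  step size, and the Lipschitz bound transports it to \<open>z (Suc t)\<close>.\<close>

lemma stationarity_gap_le: "stationarity_gap F (z (Suc t)) \<le> K * dist (z (Suc t)) (z t)"
proof -
  define d where "d = dist (z (Suc t)) (z t)"
  have norm_a: "norm (a (Suc t) - a t) \<le> d" and norm_b: "norm (b (Suc t) - b t) \<le> d"
    by (simp_all add: d_def dist_norm norm_fst_le norm_snd_le)
  have in_U: "z t \<in> U" "z (Suc t) \<in> U" "(a t, b (Suc t)) \<in> U"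
    using C_in_U C(3) mid_in_C by auto
  have "norm (tangent_proj (a (Suc t) $ j) (grad_alpha F (z (Suc t)) $ j)) \<le> (1 / ga_lo + L) * d" for j
  proof -
    let ?G = "grad_alpha F (z (Suc t))" and ?H = "grad_alpha F (a t, b (Suc t))"
    have "norm (a (Suc t) $ j) = 1"
      using a_in by (simp add: constraint_set_def)
    then have "norm (tangent_proj (a (Suc t) $ j) ((?G - ?H) $ j)) \<le> norm ((?G - ?H) $ j)"
      by (rule norm_tangent_proj_le)
    also have "\<dots> \<le> norm (?G - ?H)"
      by (rule Finite_Cartesian_Product.norm_nth_le)
    also have "\<dots> = norm (fst (grad F (z (Suc t)) - grad F (a t, b (Suc t))))"
      by (simp add: grad_alpha_def)
    also have "\<dots> \<le> norm (grad F (z (Suc t)) - grad F (a t, b (Suc t)))"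
      by (metis norm_fst_le prod.collapse)
    also have "\<dots> \<le> L * dist (z (Suc t)) (a t, b (Suc t))"
      using in_U by (intro lip)
    also have "\<dots> \<le> L * d"
      using norm_a L_pos by (simp add: dist_norm norm_Pair)
    finally have 1: "norm (tangent_proj (a (Suc t) $ j) ((?G - ?H) $ j)) \<le> L * d" .
    have "norm (tangent_proj (a (Suc t) $ j) (?H $ j)) \<le> norm (a (Suc t) - a t) / ga t"
      using a_in a_Suc ga_pos by (rule norm_tangent_proj_projA_step_le)
    also have "\<dots> \<le> d / ga_lo"
      using norm_a ga(1,2) by (intro frac_le) (auto simp: d_def)
    finally show ?thesis
      using 1 norm_triangle_ineq[of "tangent_proj (a (Suc t) $ j) (?H $ j)"
          "tangent_proj (a (Suc t) $ j) ((?G - ?H) $ j)"]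
      by (simp add: tangent_proj_diff algebra_simps)
  qed
  then have "(\<Sum>j\<in>UNIV. norm (tangent_proj (a (Suc t) $ j) (grad_alpha F (z (Suc t)) $ j)))
      \<le> (\<Sum>j\<in>(UNIV::'m set). (1 / ga_lo + L) * d)"
    by (rule sum_mono)
  moreover have "norm (grad_beta F (z (Suc t))) \<le> (1 / gb_lo + L) * d"
  proof -
    have "norm (grad_beta F (z (Suc t)) - grad_beta F (z t))
        = norm (snd (grad F (z (Suc t)) - grad F (z t)))"
      by (simp add: grad_beta_def)
    also have "\<dots> \<le> norm (grad F (z (Suc t)) - grad F (z t))"
      by (metis norm_snd_le prod.collapse)
    also have "\<dots> \<le> L * d"
      unfolding d_def using in_U by (intro lip)
    finally have 1: "norm (grad_beta F (z (Suc t)) - grad_beta F (z t)) \<le> L * d" .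
    have "norm (grad_beta F (z t)) = norm (b (Suc t) - b t) / gb t"
      using gb_pos[of t] by (simp add: b_Suc)
    also have "\<dots> \<le> d / gb_lo"
      using norm_b gb(1,2) by (intro frac_le) (auto simp: d_def)
    finally show ?thesis
      using 1 norm_triangle_sub[of "grad_beta F (z (Suc t))" "grad_beta F (z t)"]
      by (simp add: algebra_simps)
  qed
  ultimately show ?thesis
    unfolding stationarity_gap_def K_def fst_conv d_def[symmetric] by (simp add: algebra_simps)
qed

section \<open>Square-summable steps and limits of the iterates\<close>

lemma sum_steps_bounded: "\<exists>B. \<forall>T. (\<Sum>t<T. (dist (z (Suc t)) (z t))\<^sup>2) \<le> B"
proof -
  obtain m where m: "m \<le> F (z t)" for t
    using bdd \<Omega>(2) unfolding bdd_below_def by blast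
  have "c * (\<Sum>t<T. (dist (z (Suc t)) (z t))\<^sup>2) \<le> F (z 0) - F (z T)" for T
  proof (induction T)
    case (Suc T)
    then show ?case
      using sufficient_decrease[of T] by (simp add: algebra_simps)
  qed simp
  then have "c * (\<Sum>t<T. (dist (z (Suc t)) (z t))\<^sup>2) \<le> F (z 0) - m" for T
    using m[of T] by (meson diff_left_mono order_trans)
  then have "(\<Sum>t<T. (dist (z (Suc t)) (z t))\<^sup>2) \<le> (F (z 0) - m) / c" for T
    using c_pos by (simp add: field_simps)
  then show ?thesis
    by blast
qed

lemma steps_tendsto_0: "(\<lambda>t. dist (z (Suc t)) (z t)) \<longlonglongrightarrow> 0"
proof -
  obtain B where "\<And>T. (\<Sum>t<T. (dist (z (Suc t)) (z t))\<^sup>2) \<le> B"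
    using sum_steps_bounded by blast
  then have "summable (\<lambda>t. (dist (z (Suc t)) (z t))\<^sup>2)"
    by (intro summableI_nonneg_bounded) auto
  then have "(\<lambda>t. sqrt ((dist (z (Suc t)) (z t))\<^sup>2)) \<longlonglongrightarrow> sqrt 0"
    by (intro tendsto_real_sqrt summable_LIMSEQ_zero)
  then show ?thesis
    by simp
qed

lemma stationarity_gap_tendsto_0: "(\<lambda>t. stationarity_gap F (z t)) \<longlonglongrightarrow> 0"
proof -
  have "(\<lambda>t. K * dist (z (Suc t)) (z t)) \<longlonglongrightarrow> K * 0"
    by (intro tendsto_intros steps_tendsto_0)
  then have lim: "(\<lambda>t. K * dist (z (Suc t)) (z t)) \<longlonglongrightarrow> 0"
    by simp
  have "(\<lambda>t. stationarity_gap F (z (Suc t))) \<longlonglongrightarrow> 0"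
    by (rule tendsto_sandwich[OF _ _ tendsto_const lim])
      (simp_all add: stationarity_gap_nonneg stationarity_gap_le)
  then show ?thesis
    by (rule LIMSEQ_imp_Suc)
qed

lemma tendsto_grad:
  assumes "p \<in> U" "(f \<longlongrightarrow> p) G"
  shows "((\<lambda>t. grad F (f t)) \<longlongrightarrow> grad F p) G"
proof -
  have "continuous_on U (grad F)"
    using lip L_pos by (intro lipschitz_on_continuous_on[of L] lipschitz_onI) (auto simp: dist_norm)
  then show ?thesis
    using assms U by (simp add: continuous_on_eq_continuous_at isCont_tendsto_compose)
qed

lemma accumulation_point_mem:
  assumes "(z \<circ> r) \<longlonglongrightarrow> p"
  shows "p \<in> C" "p \<in> U" "p \<in> \<Omega>"
proof -
  show "p \<in> C"
    using C(1,3) assms by (auto intro: closed_sequentially[of C "z \<circ> r"])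
  then show "p \<in> U"
    by (rule C_in_U)
  show "p \<in> \<Omega>"
    using compact_imp_closed[OF \<Omega>(3)] \<Omega>(2) assms by (auto intro: closed_sequentially[of \<Omega> "z \<circ> r"])
qed

text \<open>The gap tends to 0 along the whole sequence and is continuous along the subsequence, so
  it vanishes at the limit.\<close>

lemma accumulation_point_stationary:
  assumes "strict_mono r" and lim: "(z \<circ> r) \<longlonglongrightarrow> p"
  shows "stationary F p"
proof -
  have "(\<lambda>k. grad F (z (r k))) \<longlonglongrightarrow> grad F p"
    using tendsto_grad[OF accumulation_point_mem(2)[OF lim] lim] by (simp add: o_def)
  then have "(\<lambda>k. stationarity_gap F (z (r k))) \<longlonglongrightarrow> stationarity_gap F p"
    using lim unfolding stationarity_gap_def grad_alpha_def grad_beta_def tangent_proj_def o_def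
    by (intro tendsto_intros)
  moreover have "(\<lambda>k. stationarity_gap F (z (r k))) \<longlonglongrightarrow> 0"
    using LIMSEQ_subseq_LIMSEQ[OF stationarity_gap_tendsto_0 assms(1)] by (simp add: o_def)
  ultimately show ?thesis
    unfolding stationary_iff_gap_eq_0 by (rule LIMSEQ_unique)
qed

lemma riem_grad_in_limiting_subdiff:
  assumes "p \<in> U" "p \<in> \<Omega>"
  shows "riem_grad F p \<in> limiting_subdiff (Psi F) p"
proof -
  have "fst p \<in> constraint_set"
    using assms(2) \<Omega>(1) by auto
  then show ?thesis
    using riem_grad_in_frechet_subdiff[OF diff[OF assms(1)]] frechet_subdiff_subset_limiting by blast
qed

text \<open>Compactness supplies the accumulation point; monotone convergence of the values and
  continuity of \<open>F\<close> identify their limit as \<open>F p\<close>.\<close>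

lemma KL_convergence:
  assumes KL: "KL_function (Psi F)"
  shows "\<exists>p. z \<longlonglongrightarrow> p \<and> stationary F p"
proof -
  obtain p r where r: "strict_mono r" "(z \<circ> r) \<longlonglongrightarrow> p"
    using \<Omega>(2,3) unfolding compact_def by (metis (no_types, lifting))
  note p = accumulation_point_mem[OF r(2)]
  have \<Psi>: "Psi F q = ereal (F q)" if "q \<in> \<Omega>" for q
    using that \<Omega>(1) by (auto simp: Psi_def)
  have dec: "decseq (\<lambda>t. F (z t))"
  proof (rule decseq_SucI)
    fix t
    have "0 \<le> c * (dist (z (Suc t)) (z t))\<^sup>2"
      using c_pos by simp
    then show "F (z (Suc t)) \<le> F (z t)"
      using sufficient_decrease[of t] by linarith
  qed
  obtain m where m: "m \<le> F (z t)" for t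
    using bdd \<Omega>(2) unfolding bdd_below_def by blast
  obtain l where l: "(\<lambda>t. F (z t)) \<longlonglongrightarrow> l"
    using decseq_convergent[OF dec] m by metis
  have "isCont F p"
    using diff[OF p(2)] by (rule differentiable_imp_continuous_within)
  then have "(\<lambda>k. F (z (r k))) \<longlonglongrightarrow> F p"
    using r(2) isCont_tendsto_compose[of p F "z \<circ> r"] by (simp add: o_def)
  moreover have "(\<lambda>k. F (z (r k))) \<longlonglongrightarrow> l"
    using LIMSEQ_subseq_LIMSEQ[OF l r(1)] by (simp add: o_def)
  ultimately have lim: "(\<lambda>t. F (z t)) \<longlonglongrightarrow> F p"
    using l LIMSEQ_unique by blast
  \<comment> \<open>\<open>KL_function\<close> speaks only of points with a nonempty limiting
    subdifferential; \<open>riem_grad F p\<close> is such a subgradient.\<close>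
  have "KL_at (Psi F) p"
    using KL riem_grad_in_limiting_subdiff[OF p(2,3)] unfolding KL_function_def by blast
  then have "z \<longlonglongrightarrow> p"
  proof (rule KL_descent_sequence_converges[rotated -1])
    show "Psi F (z t) = ereal (F (z t))" for t
      by (rule \<Psi>[OF \<Omega>(2)])
    show "Psi F p = ereal (F p)"
      by (rule \<Psi>[OF p(3)])
    show "riem_grad F (z t) \<in> limiting_subdiff (Psi F) (z t)" for t
      by (intro riem_grad_in_limiting_subdiff C_in_U C(3) \<Omega>(2))
    show "norm (riem_grad F (z (Suc t))) \<le> K * dist (z (Suc t)) (z t)" for t
      using norm_riem_grad_le stationarity_gap_le by (rule order_trans)
  qed (use lim c_pos sufficient_decrease K_nonneg r in auto)
  then show ?thesis
    using accumulation_point_stationary[OF r] by blast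
qed

lemma stationarity_gap_rate:
  "(\<lambda>T. Min ((\<lambda>t. stationarity_gap F (z t)) ` {0..<T})) \<in> O(\<lambda>T. 1 / sqrt (real T))"
proof -
  obtain B where "\<And>T. (\<Sum>t<T. (dist (z (Suc t)) (z t))\<^sup>2) \<le> B"
    using sum_steps_bounded by blast
  then show ?thesis
    using stationarity_gap_nonneg stationarity_gap_le by (intro Min_bigo_inverse_sqrt)
qed

end

theorem theorem1:
  fixes ginv :: "real \<Rightarrow> real"           \<comment> \<open>inverse link g^{-1}\<close>
    and \<phi> :: "'k::finite \<Rightarrow> real \<Rightarrow> real"  \<comment> \<open>basis functions\<close>
    and loss :: "real \<Rightarrow> real \<Rightarrow> real"
    and n :: nat and x :: "nat \<Rightarrow> real^'d::finite" and y :: "nat \<Rightarrow> real"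
    and F :: "('d,'m::finite,'k) param \<Rightarrow> real"
    and a :: "nat \<Rightarrow> real^'d^'m" and b :: "nat \<Rightarrow> real^'k^'m"
    and ga gb :: "nat \<Rightarrow> real"
    and \<Omega> :: "('d,'m,'k) param set"
    and L ga_lo ga_hi gb_lo gb_hi :: real
  assumes n_pos: "n > 0"
    and alg: "(F = Ln loss ginv \<phi> n x y \<and> GD_iter F ga gb a b) \<or>
              (F = Qn ginv \<phi> n x y \<and> continuous_on UNIV ginv \<and>
               (\<forall>k. \<phi> k differentiable_on UNIV) \<and> VI_iter ginv \<phi> n x y ga gb a b)"
    and i_compact: "compact \<Omega>" "\<Omega> \<subseteq> constraint_set \<times> UNIV" "\<forall>t. (a t, b t) \<in> \<Omega>"
    and i_bdd: "bdd_below (F ` \<Omega>)"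
    and ii: "\<exists>U C. open U \<and> compact C \<and> C \<subseteq> U \<and>
              (\<forall>t. (a t, b t) \<in> C \<and>
                   closed_segment (a t, b t) (a t, b (Suc t)) \<subseteq> C \<and>
                   closed_segment (a t, b (Suc t)) (a (Suc t), b (Suc t)) \<subseteq> C) \<and>
              (\<forall>p\<in>U. F differentiable (at p)) \<and>
              (\<forall>p\<in>U. \<forall>q\<in>U. norm (grad F p - grad F q) \<le> L * dist p q)"
    and L_pos: "L > 0"
    and iii: "0 < gb_lo" "\<forall>t. gb_lo \<le> gb t \<and> gb t \<le> gb_hi" "gb_hi < 2 / L"
             "0 < ga_lo" "\<forall>t. ga_lo \<le> ga t \<and> ga t \<le> ga_hi" "ga_hi < 1 / L"
  shows "(\<forall>p r. strict_mono r \<and> ((\<lambda>t. (a t, b t)) \<circ> r) \<longlonglongrightarrow> p \<longrightarrow> stationary F p)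
       \<and> (KL_function (Psi F) \<longrightarrow>
            (\<exists>p. (\<lambda>t. (a t, b t)) \<longlonglongrightarrow> p \<and> stationary F p))
       \<and> (\<lambda>T. Min ((\<lambda>t. (\<Sum>j\<in>UNIV. norm (tangent_proj (a t $ j) (grad_alpha F (a t, b t) $ j)))
                        + norm (grad_beta F (a t, b t))) ` {0..<T}))
           \<in> O(\<lambda>T. 1 / sqrt (real T))"
proof -
  have GD: "GD_iter F ga gb a b"
    using alg VI_iter_imp_GD_iter by blast
  obtain U C where U: "open U" and C: "compact C" "C \<subseteq> U"
    and seg: "\<And>t. (a t, b t) \<in> C"
      "\<And>t. closed_segment (a t, b t) (a t, b (Suc t)) \<subseteq> C"
      "\<And>t. closed_segment (a t, b (Suc t)) (a (Suc t), b (Suc t)) \<subseteq> C"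
    and diff: "\<And>p. p \<in> U \<Longrightarrow> F differentiable (at p)"
    and lip: "\<And>p q. p \<in> U \<Longrightarrow> q \<in> U \<Longrightarrow> norm (grad F p - grad F q) \<le> L * dist p q"
    using ii by metis
  interpret projected_alternating_descent F a b ga gb \<Omega> U C L ga_lo ga_hi gb_lo gb_hi
    using GD i_compact i_bdd U compact_imp_closed[OF C(1)] C(2) seg diff lip L_pos iii
    by unfold_locales blast+
  show ?thesis
    using accumulation_point_stationary KL_convergence stationarity_gap_rate
    by (auto simp: stationarity_gap_def)
qed

end
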